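(* Let $\mathcal{H}_i=\{x\in\mathcal{X} : a_i^Tx\le b_i\}$, $i=0,\dots,n-1$, be half-spaces with unit normals $a_i$ and nonempty intersection, and let $(x_m)$, $(e_m)$ be the primary and auxiliary iterates of Dykstra's algorithm for $\mathcal{H}_0,\dots,\mathcal{H}_{n-1}$ started at a point $x^\circ\in\mathcal{X}$. Suppose that stalling starts at iteration $m$ (where $m\ge n-1$), and denote the active half-spaces by $$\mathcal{A}:=\{i\in\{0,\dots,n-1\} : x_{m+i}+e_{m-n+i}\notin\mathcal{H}_{[m+i]}\}.$$ Then the length of the stalling period, counted in $n$-step cycles, is $$N_{stall}:=\min_{i\in\mathcal{S}}\left\lceil \frac{k_{m-n+i}}{b_{[m+i]}-x_{m+i}^Ta_{[m+i]}}\right\rceil,$$ where $k_{m-n+i}=e_{m-n+i}^Ta_{[m+i]}$ and $$\mathcal{S}:=\{i\in\mathcal{A} : x_{m-n+i}^Ta_{[m+i]}-b_{[m+i]}<0\}.$$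
   Context: $\mathcal{X}\subseteq\mathbb{R}^p$ is a Euclidean space with norm $\|\cdot\|_2$. For an integer $m$, $[m]:=m \bmod n$. $\lceil\cdot\rceil$ is the ceiling operator. $\mathcal{P}_C$ denotes the Euclidean projection onto a closed convex set $C$. Dykstra's algorithm: $x_0=x^\circ$, $e_{-n}=\dots=e_{-1}=0$, and for $m\ge 0$ $$x_{m+1}=\mathcal{P}_{\mathcal{H}_{[m]}}(x_m+e_{m-n}),\qquad e_m=e_{m-n}+x_m-x_{m+1}.$$ For half-spaces this reads: if $x_m+e_{m-n}\in\mathcal{H}_{[m]}$ then $x_{m+1}=x_m+e_{m-n}$ and $e_m=0$; otherwise $x_{m+1}=x_m-(x_m^Ta_{[m]}-b_{[m]})a_{[m]}$ and $e_m=e_{m-n}+(x_m^Ta_{[m]}-b_{[m]})a_{[m]}$. Thus $e_m=k_ma_{[m]}$ with a scalar $k_m$, where $k_m=0$ in the first case and $k_m=k_{m-n}+x_m^Ta_{[m]}-b_{[m]}$ in the second. An iteration is an increase of $m$ by $1$; a cycle is $n$ consecutive iterations. Stalling (definition): given $m\ge n-1$, a stalling period is defined as those $i\in\{0,\dots,m_{stall}\}$, with $m_{stall}\ge n$, for which $x_{m+i}=x_{m+i-n}$. Stalling starts at iteration $m$ if $m$ is the first iteration of such a period. End and length of stalling: the stalling period continues until one of the half-spaces active at its start (those indexed by $\mathcal{A}$) becomes inactive, meaning that at an iteration $m'=m+i+(N-1)n$ with $i\in\mathcal{A}$, $N\ge1$, one has $x_{m'}+e_{m'-n}\in\mathcal{H}_{[m']}$;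 at this point stalling terminates. Its length in cycles is the number $N\ge 1$ of the cycle (cycle number $N$ consisting of iterations $m+(N-1)n,\dots,m+Nn-1$) in which this first happens.
   Formalization: It is assumed explicitly that the primary iterates keep repeating with period n until an initially active half-space becomes inactive; this can fail when a point lies exactly on a boundary, and then the formula can fail. If S is empty, the minimum is read as infinity. *)

theory Defs
  imports "HOL-Analysis.Analysis" "HOL-Library.Extended_Nat"
begin

definition halfspace :: "(nat \<Rightarrow> 'a::euclidean_space) \<Rightarrow> (nat \<Rightarrow> real) \<Rightarrow> nat \<Rightarrow> 'a set" where
  "halfspace a b i = {y. a i \<bullet> y \<le> b i}"

definition cyc :: "nat \<Rightarrow> int \<Rightarrow> nat" where
  "cyc n m = nat (m mod int n)"

text \<open>
  Iterates are indexed by the integers, so that the indices \<open>-n, \<dots>, -1\<close> of the auxiliary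
  sequence can be written literally and differences such as \<open>m - n\<close> are not truncated. Values at
  other negative indices are left unconstrained. The only one that is ever referred to below is
  \<open>x (-1)\<close>, when \<open>m = n - 1\<close>; statements about these iterates thus hold for any convention
  for that value.
\<close>

definition dykstra ::
    "nat \<Rightarrow> (nat \<Rightarrow> 'a::euclidean_space set) \<Rightarrow> 'a \<Rightarrow> (int \<Rightarrow> 'a) \<Rightarrow> (int \<Rightarrow> 'a) \<Rightarrow> bool" where
  "dykstra n H x0 x e \<longleftrightarrow>
     x 0 = x0 \<and>
     (\<forall>j\<in>{- int n .. -1}. e j = 0) \<and>
     (\<forall>m\<ge>0. x (m + 1) = closest_point (H (cyc n m)) (x m + e (m - int n)) \<and>
            e m = e (m - int n) + x m - x (m + 1))"

definition stalling_period :: "nat \<Rightarrow> (int \<Rightarrow> 'a) \<Rightarrow> int \<Rightarrow> int \<Rightarrow> bool" where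
  "stalling_period n x m m_stall \<longleftrightarrow>
     m \<ge> int n - 1 \<and> m_stall \<ge> int n \<and> (\<forall>i\<in>{0..m_stall}. x (m + i) = x (m + i - int n))"

text \<open>
  The last conjunct says that \<open>m\<close> is the first iteration of the period: no stalling period that
  contains iteration \<open>m\<close> begins earlier.
\<close>

definition stalling_starts :: "nat \<Rightarrow> (int \<Rightarrow> 'a) \<Rightarrow> int \<Rightarrow> bool" where
  "stalling_starts n x m \<longleftrightarrow>
     (\<exists>m_stall. stalling_period n x m m_stall) \<and>
     (\<forall>m' m_stall'. stalling_period n x m' m_stall' \<and> m \<le> m' + m_stall' \<longrightarrow> m \<le> m')"

definition inactive_at ::
    "nat \<Rightarrow> (nat \<Rightarrow> 'a::euclidean_space set) \<Rightarrow> (int \<Rightarrow> 'a) \<Rightarrow> (int \<Rightarrow> 'a) \<Rightarrow> int \<Rightarrow> bool" where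
  "inactive_at n H x e m \<longleftrightarrow> x m + e (m - int n) \<in> H (cyc n m)"

definition active_set ::
    "nat \<Rightarrow> (nat \<Rightarrow> 'a::euclidean_space set) \<Rightarrow> (int \<Rightarrow> 'a) \<Rightarrow> (int \<Rightarrow> 'a) \<Rightarrow> int \<Rightarrow> int set" where
  "active_set n H x e m =
     {i\<in>{0..<int n}. x (m + i) + e (m - int n + i) \<notin> H (cyc n (m + i))}"

definition release ::
    "nat \<Rightarrow> (nat \<Rightarrow> 'a::euclidean_space set) \<Rightarrow> (int \<Rightarrow> 'a) \<Rightarrow> (int \<Rightarrow> 'a) \<Rightarrow> int \<Rightarrow> int \<Rightarrow> nat \<Rightarrow> bool" where
  "release n H x e m i N \<longleftrightarrow>
     i \<in> active_set n H x e m \<and> N \<ge> 1 \<and>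
     inactive_at n H x e (m + i + (int N - 1) * int n)"

text \<open>
  A stalling period lasts until one of the half-spaces that are active at its start is released.
  This does not follow from \<^const>\<open>stalling_starts\<close>: if some \<open>x (m + i) + e (m + i - n)\<close> with
  \<open>0 \<le> i < n\<close> and \<open>e (m + i - n) \<noteq> 0\<close> lies exactly on the boundary of its half-space, then that
  half-space is not active at the start of the period, but the repetition may stop because its
  auxiliary vector has been reset to zero. On the real line, the half-spaces \<open>y \<le> 5/2\<close>, \<open>y \<le> 2\<close>,
  \<open>y \<le> 1\<close> and the initial point \<open>11/2\<close> give such an example, with \<open>m = 4\<close>.
\<close>

definition stalling_until_release ::
    "nat \<Rightarrow> (nat \<Rightarrow> 'a::euclidean_space set) \<Rightarrow> (int \<Rightarrow> 'a) \<Rightarrow> (int \<Rightarrow> 'a) \<Rightarrow> int \<Rightarrow> bool" where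
  "stalling_until_release n H x e m \<longleftrightarrow>
     (\<forall>j\<ge>0. (\<nexists>i N. release n H x e m i N \<and> i + (int N - 1) * int n < j) \<longrightarrow>
        x (m + j) = x (m + j - int n))"

text \<open>
  The number of the first cycle with a release. It is \<open>\<infinity>\<close> if there is none, for instance if
  the iterates have converged; this matches the infimum over an empty index set in \<^typ>\<open>enat\<close>.
\<close>

definition stalling_length ::
    "nat \<Rightarrow> (nat \<Rightarrow> 'a::euclidean_space set) \<Rightarrow> (int \<Rightarrow> 'a) \<Rightarrow> (int \<Rightarrow> 'a) \<Rightarrow> int \<Rightarrow> enat" where
  "stalling_length n H x e m = (INF N\<in>{N. \<exists>i. release n H x e m i N}. enat N)"

definition decreasing_set ::
    "nat \<Rightarrow> (nat \<Rightarrow> 'a::euclidean_space) \<Rightarrow> (nat \<Rightarrow> real) \<Rightarrow> (int \<Rightarrow> 'a) \<Rightarrow> (int \<Rightarrow> 'a) \<Rightarrow> int \<Rightarrow> int set" where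
  "decreasing_set n a b x e m =
     {i\<in>active_set n (halfspace a b) x e m.
        x (m - int n + i) \<bullet> a (cyc n (m + i)) - b (cyc n (m + i)) < 0}"

end

theory Submission
  imports Defs
begin

text \<open>
  While the iterates repeat with period \<open>n\<close>, each half-space \<open>i\<close> that was active at the start of
  stalling sees the same primary iterate in every cycle. Projecting onto it changes the scalar
  \<open>k\<close> of its auxiliary vector by the signed distance \<open>x (m + i) \<bullet> a - b\<close>, so that \<open>k\<close> is an
  arithmetic progression in the cycle number (\<open>auxiliary_progression\<close>), and the half-space is
  released in the first cycle \<open>N\<close> with \<open>k + N * (x (m + i) \<bullet> a - b) \<le> 0\<close>
  (\<open>release_iff_before_first_release\<close>). If the signed distance is negative this is the cycle
  \<open>\<lceil>k / (b - x (m + i) \<bullet> a)\<rceil>\<close>. Otherwise there is none: being active at the start means that the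
  sum is positive for \<open>N = 1\<close>, and it does not decrease.

  This description of a half-space is only valid until some half-space has been released, after
  which the iterates may move. It therefore suffices to look at the release that comes first in
  time: its cycle is given by the formula, and a smaller value of the formula for another
  half-space would have meant an earlier release.
\<close>

section \<open>Projection onto a half-space\<close>

lemma closest_point_halfspace:
  fixes a :: "nat \<Rightarrow> 'a::euclidean_space"
  assumes "norm (a i) = 1" and "y \<notin> halfspace a b i"
  shows "closest_point (halfspace a b i) y = y - (a i \<bullet> y - b i) *\<^sub>R a i"
proof (rule closest_point_unique[symmetric])
  show "convex (halfspace a b i)" "closed (halfspace a b i)"
    unfolding halfspace_def by (rule convex_halfspace_le, rule closed_halfspace_le)
  have unit: "a i \<bullet> a i = 1"
    using assms(1) by (simp add: dot_square_norm)
  have pos: "a i \<bullet> y - b i > 0"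
    using assms(2) by (simp add: halfspace_def)
  show "y - (a i \<bullet> y - b i) *\<^sub>R a i \<in> halfspace a b i"
    by (simp add: halfspace_def inner_diff_right unit)
  show "\<forall>z\<in>halfspace a b i. dist y (y - (a i \<bullet> y - b i) *\<^sub>R a i) \<le> dist y z"
  proof
    fix z assume "z \<in> halfspace a b i"
    then have "a i \<bullet> y - b i \<le> a i \<bullet> (y - z)"
      by (simp add: halfspace_def inner_diff_right)
    also have "\<dots> \<le> norm (y - z)"
      using norm_cauchy_schwarz[of "a i" "y - z"] assms(1) by simp
    finally show "dist y (y - (a i \<bullet> y - b i) *\<^sub>R a i) \<le> dist y z"
      using pos assms(1) by (simp add: dist_norm)
  qed
qed

lemma dykstra_active_step:
  fixes a :: "nat \<Rightarrow> 'a::euclidean_space"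
  assumes "dykstra n (halfspace a b) x0 x e" and "j \<ge> 0"
    and "norm (a (cyc n j)) = 1"
    and "\<not> inactive_at n (halfspace a b) x e j"
  shows "e j \<bullet> a (cyc n j) =
    e (j - int n) \<bullet> a (cyc n j) + (x j \<bullet> a (cyc n j) - b (cyc n j))"
proof -
  let ?c = "cyc n j" and ?y = "x j + e (j - int n)"
  have "x (j + 1) = closest_point (halfspace a b ?c) ?y"
    and "e j = e (j - int n) + x j - x (j + 1)"
    using assms(1,2) unfolding dykstra_def by blast+
  then have "e j = ?y - closest_point (halfspace a b ?c) ?y"
    by simp
  also have "\<dots> = (a ?c \<bullet> ?y - b ?c) *\<^sub>R a ?c"
    using closest_point_halfspace[of a ?c ?y b] assms(3,4) by (simp add: inactive_at_def)
  finally show ?thesis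
    using assms(3) by (simp add: dot_square_norm inner_add_right inner_commute)
qed

lemma inactive_at_halfspace_iff:
  "inactive_at n (halfspace a b) x e j \<longleftrightarrow>
     e (j - int n) \<bullet> a (cyc n j) + (x j \<bullet> a (cyc n j) - b (cyc n j)) \<le> 0"
proof -
  have "a (cyc n j) \<bullet> (x j + e (j - int n)) = x j \<bullet> a (cyc n j) + e (j - int n) \<bullet> a (cyc n j)"
    by (metis inner_add_left inner_commute)
  then show ?thesis
    unfolding inactive_at_def halfspace_def by auto
qed

section \<open>The auxiliary scalars during stalling\<close>

lemma cyc_add_mult [simp]: "cyc n (j + q * int n) = cyc n j"
  by (simp add: cyc_def)

lemma cyc_less: "n \<ge> 1 \<Longrightarrow> cyc n j < n"
  by (simp add: cyc_def nat_less_iff)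

lemma active_set_bounds:
  "i \<in> active_set n H x e m \<Longrightarrow> 0 \<le> i \<and> i < int n"
  by (simp add: active_set_def)

text \<open>
  By \<open>dykstra_active_step\<close>, each projection adds to the auxiliary scalar the signed distance of
  the current primary iterate, and as long as that iterate repeats the increment is the same in
  every cycle.
\<close>

lemma auxiliary_progression:
  fixes a :: "nat \<Rightarrow> 'a::euclidean_space"
  assumes "dykstra n (halfspace a b) x0 x e" and "j \<ge> 0"
    and "norm (a (cyc n j)) = 1"
    and "\<And>q. q < N \<Longrightarrow> x (j + int q * int n) = x j"
    and "\<And>q. q < N \<Longrightarrow> \<not> inactive_at n (halfspace a b) x e (j + int q * int n)"
  shows "e (j + (int N - 1) * int n) \<bullet> a (cyc n j) =
    e (j - int n) \<bullet> a (cyc n j) + real N * (x j \<bullet> a (cyc n j) - b (cyc n j))"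
  using assms(4,5)
proof (induction N)
  case 0
  then show ?case by simp
next
  case (Suc N)
  let ?j = "j + int N * int n"
  have "e ?j \<bullet> a (cyc n j) =
      e (?j - int n) \<bullet> a (cyc n j) + (x ?j \<bullet> a (cyc n j) - b (cyc n j))"
    using dykstra_active_step[OF assms(1), of ?j] assms(2,3) Suc.prems(2)[of N] by simp
  moreover have "?j - int n = j + (int N - 1) * int n"
    by (simp add: algebra_simps)
  moreover have "x ?j = x j"
    using Suc.prems(1)[of N] by simp
  moreover have "e (j + (int N - 1) * int n) \<bullet> a (cyc n j) =
      e (j - int n) \<bullet> a (cyc n j) + real N * (x j \<bullet> a (cyc n j) - b (cyc n j))"
    using Suc.prems by (intro Suc.IH) auto
  ultimately have "e ?j \<bullet> a (cyc n j) =
      e (j - int n) \<bullet> a (cyc n j) + real (Suc N) * (x j \<bullet> a (cyc n j) - b (cyc n j))"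
    by (simp only: of_nat_Suc distrib_right mult_1_left add.assoc add.commute)
  then show ?case
    by simp
qed

text \<open>
  Stalling only compares iterates one cycle apart; chaining these equalities back to the first
  cycle needs that no release precedes any of the iterations on the way.
\<close>

lemma repeats_before_release:
  assumes "stalling_until_release n H x e m" and "i \<ge> 0"
    and "\<And>i' N'. release n H x e m i' N' \<Longrightarrow> i + int q * int n \<le> i' + (int N' - 1) * int n"
  shows "x (m + i + int q * int n) = x (m + i)"
  using assms(3)
proof (induction q)
  case 0
  then show ?case by simp
next
  case (Suc q)
  let ?j = "i + int (Suc q) * int n"
  have "\<nexists>i' N'. release n H x e m i' N' \<and> i' + (int N' - 1) * int n < ?j"
    using Suc.prems by (meson linorder_not_le)
  moreover have "?j \<ge> 0"
    using assms(2) by simp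
  ultimately have "x (m + ?j) = x (m + ?j - int n)"
    using assms(1) unfolding stalling_until_release_def by blast
  moreover have "i + int q * int n \<le> i' + (int N' - 1) * int n"
    if "release n H x e m i' N'" for i' N'
    using Suc.prems[OF that] by (simp add: algebra_simps)
  then have "x (m + i + int q * int n) = x (m + i)"
    by (rule Suc.IH)
  ultimately show ?case
    by (simp add: algebra_simps)
qed

text \<open>
  Up to and including the iteration of the first release the iterates repeat, and a half-space
  that has not been released has been active in every previous cycle. Both conditions of
  \<open>auxiliary_progression\<close> then hold. The bound has the factor \<open>N\<close>, although only \<open>N - 1\<close>
  projections have been made before cycle \<open>N\<close>: the test for inactivity in that cycle adds the
  signed distance once more.
\<close>

lemma release_iff_before_first_release:
  fixes a :: "nat \<Rightarrow> 'a::euclidean_space"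
  assumes "n \<ge> 1" and "\<And>i. i < n \<Longrightarrow> norm (a i) = 1"
    and "dykstra n (halfspace a b) x0 x e" and "m \<ge> 0"
    and "stalling_until_release n (halfspace a b) x e m"
    and active: "i \<in> active_set n (halfspace a b) x e m" and "N \<ge> 1"
    and first: "\<And>i' N'. release n (halfspace a b) x e m i' N' \<Longrightarrow>
      i + (int N - 1) * int n \<le> i' + (int N' - 1) * int n"
  shows "release n (halfspace a b) x e m i N \<longleftrightarrow>
    e (m - int n + i) \<bullet> a (cyc n (m + i)) \<le>
      real N * (b (cyc n (m + i)) - x (m + i) \<bullet> a (cyc n (m + i)))"
proof -
  obtain M where N: "N = Suc M"
    using \<open>N \<ge> 1\<close> by (cases N) auto
  let ?c = "cyc n (m + i)" and ?j = "m + i"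
  have i: "0 \<le> i" "i < int n"
    using active_set_bounds[OF active] by auto
  have repeats: "x (?j + int q * int n) = x ?j" if "q < N" for q
  proof (rule repeats_before_release[OF assms(5) i(1)])
    fix i' N' assume "release n (halfspace a b) x e m i' N'"
    then have "i + (int N - 1) * int n \<le> i' + (int N' - 1) * int n"
      by (rule first)
    moreover have "int q * int n \<le> (int N - 1) * int n"
      using that by (intro mult_right_mono) auto
    ultimately show "i + int q * int n \<le> i' + (int N' - 1) * int n"
      by linarith
  qed
  have unreleased: "\<not> inactive_at n (halfspace a b) x e (?j + int q * int n)" if "q < M" for q
  proof
    assume "inactive_at n (halfspace a b) x e (?j + int q * int n)"
    then have "release n (halfspace a b) x e m i (Suc q)"
      using active by (simp add: release_def)
    from first[OF this] have "int M * int n \<le> int q * int n"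
      by (simp add: N)
    then show False
      using that \<open>n \<ge> 1\<close> by simp
  qed
  have "e (?j + (int M - 1) * int n) \<bullet> a ?c =
      e (?j - int n) \<bullet> a ?c + real M * (x ?j \<bullet> a ?c - b ?c)"
    using assms(1-4) i repeats unreleased
    by (intro auxiliary_progression) (auto simp: N cyc_less)
  moreover have "?j + int M * int n - int n = ?j + (int M - 1) * int n"
    by (simp add: algebra_simps)
  moreover have "x (?j + int M * int n) = x ?j"
    using repeats[of M] by (simp add: N)
  moreover have "m - int n + i = ?j - int n"
    by simp
  moreover have "release n (halfspace a b) x e m i N \<longleftrightarrow>
      inactive_at n (halfspace a b) x e (?j + int M * int n)"
    using active by (simp add: release_def N)
  ultimately have "release n (halfspace a b) x e m i N \<longleftrightarrow>
      e (m - int n + i) \<bullet> a ?c + real M * (x ?j \<bullet> a ?c - b ?c) + (x ?j \<bullet> a ?c - b ?c) \<le> 0"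
    unfolding inactive_at_halfspace_iff cyc_add_mult by (simp only:)
  then show ?thesis
    by (simp add: N algebra_simps)
qed

section \<open>The length of stalling\<close>

lemma cycle_order:
  assumes "0 \<le> i" "i < int n" "0 \<le> i'" "N < N'"
  shows "i + (int N - 1) * int n < i' + (int N' - 1) * int n"
proof -
  have "int N * int n \<le> (int N' - 1) * int n"
    using assms by (intro mult_right_mono) auto
  then show ?thesis
    using assms by (simp add: algebra_simps)
qed

theorem theorem2:
  fixes a :: "nat \<Rightarrow> 'a::euclidean_space" and b :: "nat \<Rightarrow> real" and n :: nat
    and x0 :: 'a and x e :: "int \<Rightarrow> 'a" and m :: int
  assumes "n \<ge> 1"
    and "\<And>i. i < n \<Longrightarrow> norm (a i) = 1"
    and "(\<Inter>i<n. halfspace a b i) \<noteq> {}"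
    and "dykstra n (halfspace a b) x0 x e"
    and "stalling_starts n x m"
    and "stalling_until_release n (halfspace a b) x e m"
  shows "stalling_length n (halfspace a b) x e m =
    (INF i\<in>decreasing_set n a b x e m.
       enat (nat \<lceil>(e (m - int n + i) \<bullet> a (cyc n (m + i))) /
                  (b (cyc n (m + i)) - x (m + i) \<bullet> a (cyc n (m + i)))\<rceil>))"
proof -
  let ?rel = "release n (halfspace a b) x e m"
  let ?A = "active_set n (halfspace a b) x e m"
  let ?S = "decreasing_set n a b x e m"
  \<comment> \<open>\<open>m + T i N\<close> is the iteration at which half-space \<open>i\<close> is visited in cycle \<open>N\<close>.\<close>
  define T where "T i N = i + (int N - 1) * int n" for i N
  define k where "k i = e (m - int n + i) \<bullet> a (cyc n (m + i))" for i
  define d where "d i = b (cyc n (m + i)) - x (m + i) \<bullet> a (cyc n (m + i))" for i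
  define C where "C i = nat \<lceil>k i / d i\<rceil>" for i

  obtain m_stall where stall: "stalling_period n x m m_stall"
    using assms(5) by (auto simp: stalling_starts_def)
  have "m \<ge> 0"
    using stall assms(1) by (simp add: stalling_period_def)
  have criterion: "?rel i N \<longleftrightarrow> k i \<le> real N * d i"
    if "i \<in> ?A" "N \<ge> 1" "\<And>i' N'. ?rel i' N' \<Longrightarrow> T i N \<le> T i' N'" for i N
    unfolding k_def d_def
    by (rule release_iff_before_first_release[OF assms(1,2,4) \<open>m \<ge> 0\<close> assms(6)])
      (use that in \<open>auto simp: T_def\<close>)

  have S_iff: "i \<in> ?S \<longleftrightarrow> i \<in> ?A \<and> d i > 0" for i
  proof (cases "i \<in> ?A")
    case True
    then have "x (m + i) = x (m + i - int n)"
      using stall by (auto simp: stalling_period_def active_set_def)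
    then show ?thesis
      using True by (simp add: decreasing_set_def d_def algebra_simps)
  qed (simp add: decreasing_set_def)
  have k_gt_d: "k i > d i" if "i \<in> ?A" for i
  proof -
    have shift: "m + i - int n = m - int n + i"
      by simp
    have "\<not> inactive_at n (halfspace a b) x e (m + i)"
      using that unfolding active_set_def inactive_at_def shift by simp
    then show ?thesis
      unfolding inactive_at_halfspace_iff k_def d_def shift by simp
  qed
  have C_ge_1: "C i \<ge> 1" and C_crossed: "k i \<le> real (C i) * d i" if "i \<in> ?S" for i
  proof -
    have "d i > 0" "k i > d i"
      using that k_gt_d S_iff by auto
    then have "k i / d i > 1"
      by simp
    then show "C i \<ge> 1"
      unfolding C_def by linarith
    have "k i / d i \<le> real (C i)"
      unfolding C_def by (rule of_nat_ceiling)
    then show "k i \<le> real (C i) * d i"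
      using \<open>d i > 0\<close> by (simp add: divide_le_eq)
  qed

  have "(INF N\<in>{N. \<exists>i. ?rel i N}. enat N) = (INF i\<in>?S. enat (C i))"
  proof (cases "\<exists>i N. ?rel i N")
    case False
    \<comment> \<open>Without any release the criterion holds at all times, so that an element of \<open>?S\<close> would be
      released in cycle \<open>C i\<close>. Hence both infima are over the empty set.\<close>
    then have "i \<notin> ?S" for i
      using criterion[of i "C i"] C_ge_1[of i] C_crossed[of i] S_iff[of i] by auto
    then have "?S = {}"
      by blast
    then show ?thesis
      using False by simp
  next
    case True
    then obtain p0 where p0: "case_prod ?rel p0"
      by auto
    \<comment> \<open>Several half-spaces may be released in the same cycle, and only for the first of them are
      the iterates known to repeat. So the minimum is taken over iterations, not cycles.\<close>
    define p where "p = arg_min (\<lambda>p. nat (case_prod T p)) (case_prod ?rel)"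
    obtain i N where p: "p = (i, N)"
      by (cases p)
    have rel: "?rel i N"
      using arg_min_natI[of "case_prod ?rel", OF p0, of "\<lambda>p. nat (case_prod T p)"] p
      by (simp add: p_def)
    have nat_min: "nat (T i N) \<le> nat (T i' N')" if "?rel i' N'" for i' N'
      using arg_min_nat_le[of "case_prod ?rel" "(i', N')" "\<lambda>p. nat (case_prod T p)"] that p
      by (simp add: p_def)
    have T_nonneg: "T i' N' \<ge> 0" if "?rel i' N'" for i' N'
    proof -
      have "i' \<ge> 0" "N' \<ge> 1"
        using that active_set_bounds unfolding release_def by blast+
      then show ?thesis
        unfolding T_def by simp
    qed
    have first: "T i N \<le> T i' N'" if "?rel i' N'" for i' N'
      using nat_min[OF that] T_nonneg[OF that] by linarith
    have iA: "i \<in> ?A" and "N \<ge> 1"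
      using rel by (auto simp: release_def)
    have T_less: "T i1 N1 < T i2 N2" if "i1 \<in> ?A" "i2 \<in> ?A" "N1 < N2" for i1 i2 N1 N2
      unfolding T_def
      by (rule cycle_order) (use that active_set_bounds in \<open>blast+\<close>)

    have N_le: "N \<le> N'" if "?rel i' N'" for i' N'
    proof (rule leI, rule notI)
      assume "N' < N"
      moreover have "i' \<in> ?A"
        using that by (simp add: release_def)
      ultimately show False
        using T_less[OF _ iA] first[OF that] by (meson linorder_not_le)
    qed
    have N_le_C: "N \<le> C i'" if "i' \<in> ?S" for i'
    proof (rule ccontr)
      assume "\<not> N \<le> C i'"
      moreover have "i' \<in> ?A"
        using that S_iff by blast
      ultimately have earlier: "T i' (C i') < T i N"
        using T_less iA by simp
      then have "T i' (C i') \<le> T i'' N''" if "?rel i'' N''" for i'' N''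
        using first[OF that] by linarith
      then have "?rel i' (C i')"
        using criterion[OF \<open>i' \<in> ?A\<close> C_ge_1[OF that]] C_crossed[OF that] by simp
      then show False
        using first[of i' "C i'"] earlier by simp
    qed

    have "k i \<le> real N * d i"
      using criterion[OF iA \<open>N \<ge> 1\<close> first] rel by simp
    \<comment> \<open>An active half-space with \<open>d i \<le> 0\<close> cannot cross: \<open>k i > d i \<ge> N * d i\<close>.\<close>
    have "d i > 0"
    proof (rule ccontr)
      assume "\<not> d i > 0"
      then have "real N * d i \<le> 1 * d i"
        using \<open>N \<ge> 1\<close> by (intro mult_right_mono_neg) auto
      then show False
        using \<open>k i \<le> real N * d i\<close> k_gt_d[OF iA] by simp
    qed
    then have "k i / d i \<le> real N"
      using \<open>k i \<le> real N * d i\<close> by (simp add: divide_le_eq)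
    then have "C i \<le> N"
      unfolding C_def by (simp add: ceiling_le_iff nat_le_iff)
    moreover have "i \<in> ?S"
      using S_iff iA \<open>d i > 0\<close> by blast
    ultimately have "(INF i\<in>?S. enat (C i)) = enat N"
      using N_le_C by (intro antisym INF_greatest INF_lower2[of i]) auto
    moreover have "(INF N\<in>{N. \<exists>i. ?rel i N}. enat N) = enat N"
      using rel N_le by (intro antisym INF_greatest INF_lower2[of N]) auto
    ultimately show ?thesis
      by simp
  qed
  then show ?thesis
    by (simp add: stalling_length_def C_def k_def d_def)
qed

end
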